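(* Let $f$ be a convex quartic polynomial on $\mathbb{E}$ with positive definite quartic form $f_4$ satisfying $\mu\|x\|^4\le f_4[x]^4\le L\|x\|^4$ for all $x\in\mathbb{E}$ with constants $0<\mu\le L$, let $q=\mu/L$, and let $\psi$ be a closed convex function. Put $$\kappa=\left(\frac q5\right)^{1/3},\qquad \tau_\#=\frac12-\frac{1}{6(1+5\kappa)},\qquad \alpha_\#=\frac{\kappa}{1+5\kappa}.$$ Let the sequence $\{x_k\}_{k\ge0}$ be generated by the Relaxed Quartic Newton Method (described in the context) with parameter $\tau=\tau_\#$ for the problem $F^*=\min_{x\in\mathrm{dom}\,\psi}[F(x)=f(x)+\psi(x)]$. Then, for all $k\ge0$, we have $$F(x_k)-F^*\le(1-\alpha_\#)^k\,(F(x_0)-F^* ).$$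
   Context: $\mathbb{E}$ is a finite-dimensional real vector space with dual pairing $\langle\cdot,\cdot\rangle$ and an arbitrary norm $\|\cdot\|$. $f:\mathbb{E}\to\mathbb{R}$ is a convex polynomial of degree four and $f_4=\frac1{24}D^4f$ is its symmetric $4$-linear form, $f_4[x]^4=f_4[x,x,x,x]$; positive definiteness means $f_4[x]^4>0$ for all $x\ne0$. $\psi$ is a closed convex function with nonempty domain $\mathrm{dom}\,\psi\subseteq\mathbb{E}$. Put $$\hat\phi_{x,\tau}(y)=f(x)+\langle\nabla f(x),y-x\rangle+\frac{1+3\tau}{6\tau}\langle\nabla^2f(x)(y-x),y-x\rangle+(1+2\tau)L\|y-x\|^4 .$$ Relaxed Quartic Newton Method: choose $x_0\in\mathrm{dom}\,\psi$ and $\tau\in\left(\frac13,\frac12\right)$; for $k\ge0$ let $x_{k+1}$ be a minimizer over $y\in\mathrm{dom}\,\psi$ of $\hat\phi_{x_k,\tau}(y)+\psi(y)$. *)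

theory Defs
  imports "HOL-Analysis.Analysis"
begin

text \<open>
  The degree-graded version of \<^const>\<open>real_polynomial_function\<close>: polynomial functions of
  degree at most the given bound.
\<close>
inductive polynomial_fun_le :: "nat \<Rightarrow> ('a::real_normed_vector \<Rightarrow> real) \<Rightarrow> bool" where
  const: "polynomial_fun_le n (\<lambda>x. c)"
| linear: "bounded_linear g \<Longrightarrow> polynomial_fun_le 1 g"
| add: "polynomial_fun_le n g \<Longrightarrow> polynomial_fun_le n h \<Longrightarrow> polynomial_fun_le n (\<lambda>x. g x + h x)"
| mult: "polynomial_fun_le m g \<Longrightarrow> polynomial_fun_le n h \<Longrightarrow> polynomial_fun_le (m + n) (\<lambda>x. g x * h x)"

lemma polynomial_fun_le_mono:
  assumes "polynomial_fun_le m f" "m \<le> n"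
  shows "polynomial_fun_le n f"
proof -
  have "polynomial_fun_le (m + (n - m)) (\<lambda>x. f x * 1)"
    using assms(1) by (intro polynomial_fun_le.mult polynomial_fun_le.const)
  with assms(2) show ?thesis by simp
qed

lemma real_polynomial_function_iff_polynomial_fun_le:
  "real_polynomial_function f \<longleftrightarrow> (\<exists>n. polynomial_fun_le n f)"
proof
  assume "real_polynomial_function f"
  then show "\<exists>n. polynomial_fun_le n f"
  proof induction
    case (linear f)
    then show ?case using polynomial_fun_le.linear by blast
  next
    case (const c)
    then show ?case using polynomial_fun_le.const by blast
  next
    case (add f g)
    then obtain m n where "polynomial_fun_le m f" "polynomial_fun_le n g" by blast
    then have "polynomial_fun_le (max m n) f" "polynomial_fun_le (max m n) g"
      by (auto intro: polynomial_fun_le_mono)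
    then show ?case using polynomial_fun_le.add by blast
  next
    case (mult f g)
    then show ?case using polynomial_fun_le.mult by blast
  qed
next
  assume "\<exists>n. polynomial_fun_le n f"
  then obtain n where "polynomial_fun_le n f" by blast
  then show "real_polynomial_function f"
    by induction (auto intro: real_polynomial_function.intros)
qed

text \<open>
  For smooth \<open>f\<close>, the value \<open>D\<^sup>mf(x)[h\<^sub>1,\<dots>,h\<^sub>m]\<close> of the \<open>m\<close>-th differential at \<open>x\<close> on the list
  \<open>[h\<^sub>1,\<dots>,h\<^sub>m]\<close> of directions. The dual space does not appear explicitly: the pairings
  \<open>\<langle>\<nabla>f(x), h\<rangle>\<close> and \<open>\<langle>\<nabla>\<^sup>2f(x)h, h\<rangle>\<close> are \<open>higher_deriv f [h] x\<close> and \<open>higher_deriv f [h, h] x\<close>.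
\<close>
fun higher_deriv :: "('a::real_normed_vector \<Rightarrow> real) \<Rightarrow> 'a list \<Rightarrow> 'a \<Rightarrow> real" where
  "higher_deriv f [] = f"
| "higher_deriv f (h # hs) = (\<lambda>x. frechet_derivative (higher_deriv f hs) (at x) h)"

text \<open>
  The fourth differential of a polynomial of degree at most four does not depend on the base
  point, so it may be taken at the origin.
\<close>
definition quartic_form ::
    "('a::real_normed_vector \<Rightarrow> real) \<Rightarrow> 'a \<Rightarrow> 'a \<Rightarrow> 'a \<Rightarrow> 'a \<Rightarrow> real" where
  "quartic_form f h1 h2 h3 h4 = higher_deriv f [h1, h2, h3, h4] 0 / 24"

text \<open>
  An extended-valued function \<open>\<psi>\<close> with values in the reals and plus infinity is represented by
  its effective domain \<open>D\<close> and its values on \<open>D\<close>; values of \<open>\<psi>\<close> outside \<open>D\<close> are irrelevant.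
  Closedness is closedness of the epigraph.
\<close>
definition closed_convex_fun :: "'a::real_normed_vector set \<Rightarrow> ('a \<Rightarrow> real) \<Rightarrow> bool" where
  "closed_convex_fun D \<psi> \<longleftrightarrow> convex_on D \<psi> \<and> closed (epigraph D \<psi>)"

definition relaxed_model ::
    "('a::real_normed_vector \<Rightarrow> real) \<Rightarrow> real \<Rightarrow> 'a \<Rightarrow> real \<Rightarrow> 'a \<Rightarrow> real" where
  "relaxed_model f L x \<tau> y =
     f x + higher_deriv f [y - x] x
       + (1 + 3 * \<tau>) / (6 * \<tau>) * higher_deriv f [y - x, y - x] x
       + (1 + 2 * \<tau>) * L * norm (y - x) ^ 4"

definition relaxed_quartic_newton ::
    "('a::real_normed_vector \<Rightarrow> real) \<Rightarrow> real \<Rightarrow> 'a set \<Rightarrow> ('a \<Rightarrow> real) \<Rightarrow> real \<Rightarrow> (nat \<Rightarrow> 'a) \<Rightarrow> bool" where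
  "relaxed_quartic_newton f L D \<psi> \<tau> x \<longleftrightarrow>
     1 / 3 < \<tau> \<and> \<tau> < 1 / 2 \<and> x 0 \<in> D \<and>
     (\<forall>k. is_arg_min (\<lambda>y. relaxed_model f L (x k) \<tau> y + \<psi> y) (\<lambda>y. y \<in> D) (x (Suc k)))"

end

theory Submission
  imports Defs
begin

text \<open>
  On every line \<open>f\<close> is a quartic polynomial in one variable. Write \<open>a\<close>, \<open>b\<close>, \<open>c\<close> for
  \<open>D\<^sup>2f(x)[h]\<^sup>2\<close>, \<open>D\<^sup>3f(x)[h]\<^sup>3\<close> and \<open>f\<^sub>4[h]\<^sup>4\<close>. Convexity says that the second derivative along the
  line, \<open>a + t b + 12 t\<^sup>2 c\<close>, is nonnegative for all real \<open>t\<close>. At \<open>t = \<tau>\<close> and \<open>t = -\<tau>\<close> this bounds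
  the cubic Taylor term by the even ones: \<open>|b|/6 \<le> a/(6\<tau>) + 2\<tau> c\<close>
  (\<open>convex_quartic_third_deriv_bound\<close>). Replacing the cubic term by plus or minus this bound in the
  exact Taylor formula and estimating \<open>c\<close> by \<open>L\<close> and \<open>\<mu>\<close> encloses \<open>f\<close> between two models without cubic term: from above by
  the model that the method minimizes, and from below by the same expression with the smaller
  coefficients \<open>(3\<tau> - 1)/(6\<tau>)\<close> and \<open>(1 - 2\<tau>)\<mu>\<close>.

  Contracting the displacement \<open>y - x\<close> by a factor \<open>\<alpha>\<close> multiplies the quadratic term of the upper
  model by \<open>\<alpha>\<^sup>2\<close> and its quartic term by \<open>\<alpha>\<^sup>4\<close>, so for small \<open>\<alpha>\<close> the upper model at
  \<open>x + \<alpha>(y - x)\<close> lies below \<open>\<alpha>\<close> times the lower model at \<open>y\<close> plus \<open>(1 - \<alpha>) f(x)\<close>. With convexity of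
  \<open>\<psi>\<close>, the next iterate \<open>x'\<close> satisfies \<open>F(x') \<le> (1 - \<alpha>) F(x) + \<alpha> F(y)\<close> for every
  feasible \<open>y\<close> (\<open>relaxed_newton_step\<close>). The stated parameters are such that \<open>\<alpha>\<close> is small enough
  for both terms; taking \<open>y\<close> to be a minimizer of \<open>F\<close> and iterating gives the rate.

  The minimizer exists because \<open>F\<close> is lower semicontinuous and coercive: \<open>f\<close> grows like the fourth
  power of the distance, and \<open>\<psi>\<close>, being convex, decreases at most linearly. Compactness of closed
  balls, which holds as the space has a finite spanning set, then yields the minimum.
\<close>

section \<open>Derivatives of polynomial functions of bounded degree\<close>

lemma polynomial_fun_le_0_constant:
  assumes "polynomial_fun_le 0 f"
  shows "\<exists>c. f = (\<lambda>x. c)"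
proof -
  have "n = 0 \<longrightarrow> (\<exists>c. g = (\<lambda>x. c))" if "polynomial_fun_le n g" for n and g :: "'a \<Rightarrow> real"
    using that by induction auto
  then show ?thesis using assms by blast
qed

text \<open>
  The drop in degree is what makes the fourth differential of a quartic constant and its Taylor
  expansion exact. Stating it together with differentiability lets one induction over the
  construction of \<open>f\<close> prove both, by the sum and product rules.
\<close>

lemma polynomial_fun_le_has_derivative:
  fixes f :: "'a::real_normed_vector \<Rightarrow> real"
  assumes "polynomial_fun_le n f"
  shows "\<exists>f'. (\<forall>x. (f has_derivative f' x) (at x)) \<and> (\<forall>h. polynomial_fun_le (n - 1) (\<lambda>x. f' x h))"
  using assms
proof induction
  case (const n c)
  show ?case
    by (intro exI[of _ "\<lambda>x h. 0"]) (auto intro: polynomial_fun_le.const)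
next
  case (linear g)
  then show ?case
    by (intro exI[of _ "\<lambda>x. g"])
      (auto intro: polynomial_fun_le.const bounded_linear_imp_has_derivative)
next
  case (add n g h)
  then obtain g' h' where
    "\<forall>x. (g has_derivative g' x) (at x)" "\<forall>v. polynomial_fun_le (n - 1) (\<lambda>x. g' x v)"
    "\<forall>x. (h has_derivative h' x) (at x)" "\<forall>v. polynomial_fun_le (n - 1) (\<lambda>x. h' x v)"
    by blast
  then show ?case
    by (intro exI[of _ "\<lambda>x v. g' x v + h' x v"])
      (auto intro: polynomial_fun_le.add has_derivative_add)
next
  case (mult m g n h)
  then obtain g' h' where
    g': "\<And>x. (g has_derivative g' x) (at x)" "\<And>v. polynomial_fun_le (m - 1) (\<lambda>x. g' x v)" and
    h': "\<And>x. (h has_derivative h' x) (at x)" "\<And>v. polynomial_fun_le (n - 1) (\<lambda>x. h' x v)"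
    by blast
  have left: "polynomial_fun_le (m + n - 1) (\<lambda>x. g x * h' x v)" for v
  proof (cases "n = 0")
    case True
    \<comment> \<open>The truncated difference \<open>n - 1\<close> is off by one here, but the factor \<open>h\<close> is constant.\<close>
    then obtain c where "h = (\<lambda>x. c)"
      using mult polynomial_fun_le_0_constant by blast
    then have "(h has_derivative (\<lambda>v. 0)) (at x)" for x by simp
    then have "h' x = (\<lambda>v. 0)" for x
      using h'(1) has_derivative_unique by blast
    then show ?thesis by (simp add: polynomial_fun_le.const)
  next
    case False
    then show ?thesis using polynomial_fun_le.mult[OF mult.hyps(1) h'(2)[of v]] by simp
  qed
  have right: "polynomial_fun_le (m + n - 1) (\<lambda>x. g' x v * h x)" for v
  proof (cases "m = 0")
    case True
    then obtain c where "g = (\<lambda>x. c)"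
      using mult polynomial_fun_le_0_constant by blast
    then have "(g has_derivative (\<lambda>v. 0)) (at x)" for x by simp
    then have "g' x = (\<lambda>v. 0)" for x
      using g'(1) has_derivative_unique by blast
    then show ?thesis by (simp add: polynomial_fun_le.const)
  next
    case False
    then show ?thesis using polynomial_fun_le.mult[OF g'(2)[of v] mult.hyps(2)] by simp
  qed
  show ?case
    using has_derivative_mult[OF g'(1) h'(1)] polynomial_fun_le.add[OF left right]
    by (intro exI[of _ "\<lambda>x v. g x * h' x v + g' x v * h x"]) auto
qed

lemma polynomial_fun_le_differentiable:
  "polynomial_fun_le n f \<Longrightarrow> f differentiable (at x)"
  using polynomial_fun_le_has_derivative unfolding differentiable_def by blast

lemma polynomial_fun_le_frechet_derivative:
  assumes "polynomial_fun_le n f"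
  shows "polynomial_fun_le (n - 1) (\<lambda>x. frechet_derivative f (at x) h)"
proof -
  obtain f' where f': "\<And>x. (f has_derivative f' x) (at x)"
      "polynomial_fun_le (n - 1) (\<lambda>x. f' x h)"
    using polynomial_fun_le_has_derivative[OF assms] by blast
  then have "f' x = frechet_derivative f (at x)" for x
    by (intro frechet_derivative_at)
  then show ?thesis using f'(2) by simp
qed

lemma polynomial_fun_le_higher_deriv:
  "polynomial_fun_le n f \<Longrightarrow> polynomial_fun_le (n - length hs) (higher_deriv f hs)"
proof (induction hs)
  case (Cons h hs)
  then show ?case
    using polynomial_fun_le_frechet_derivative[of "n - length hs" "higher_deriv f hs" h] by simp
qed simp

lemma polynomial_fun_le_continuous:
  "polynomial_fun_le n f \<Longrightarrow> continuous_on UNIV f"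
  using polynomial_fun_le_differentiable
  by (metis continuous_at_imp_continuous_on differentiable_imp_continuous_within)

text \<open>
  Restricting \<open>f\<close> to the line through \<open>x\<close> in direction \<open>h\<close> reduces the calculus to one variable:
  the derivatives of the restriction are the higher differentials on copies of \<open>h\<close>.
\<close>

lemma higher_deriv_line:
  assumes "polynomial_fun_le n f"
  shows "((\<lambda>t. higher_deriv f hs (x + t *\<^sub>R h)) has_real_derivative
           higher_deriv f (h # hs) (x + t *\<^sub>R h)) (at t)"
proof -
  let ?g = "higher_deriv f hs"
  let ?D = "frechet_derivative ?g (at (x + t *\<^sub>R h))"
  have D: "(?g has_derivative ?D) (at (x + t *\<^sub>R h))"
    using polynomial_fun_le_differentiable[OF polynomial_fun_le_higher_deriv[OF assms]]
    by (simp add: frechet_derivative_works)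
  have "((\<lambda>t. x + t *\<^sub>R h) has_derivative (\<lambda>s. s *\<^sub>R h)) (at t)"
    by (auto intro!: derivative_eq_intros)
  from has_derivative_compose[OF this D]
  have "((\<lambda>t. ?g (x + t *\<^sub>R h)) has_derivative (\<lambda>s. ?D (s *\<^sub>R h))) (at t)" .
  moreover have "?D (s *\<^sub>R h) = ?D h * s" for s
    using linear_scale[OF has_derivative_linear[OF D]] by simp
  ultimately show ?thesis
    by (simp add: has_field_derivative_def)
qed

lemma polynomial_fun_le_taylor:
  fixes f :: "'a::real_normed_vector \<Rightarrow> real"
  assumes "polynomial_fun_le n f"
  shows "f (x + t *\<^sub>R h) = (\<Sum>m\<le>n. higher_deriv f (replicate m h) x / fact m * t ^ m)"
proof -
  define d where "d = (\<lambda>m s. higher_deriv f (replicate m h) (x + s *\<^sub>R h))"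
  have "\<forall>m s. DERIV (d m) s :> d (Suc m) s"
    unfolding d_def using higher_deriv_line[OF assms] by simp
  \<comment> \<open>The Lagrange remainder involves the differential of order \<open>n\<close>, which does not depend on the
    intermediate point.\<close>
  from Maclaurin_all_le[OF refl this, of t n] obtain s where
    s: "d 0 t = (\<Sum>m<n. d m 0 / fact m * t ^ m) + d n s / fact n * t ^ n" by blast
  have "polynomial_fun_le 0 (higher_deriv f (replicate n h))"
    using polynomial_fun_le_higher_deriv[OF assms, of "replicate n h"] by simp
  then have "d n s = d n 0"
    using polynomial_fun_le_0_constant unfolding d_def by metis
  then show ?thesis
    using s by (simp add: d_def lessThan_Suc_atMost[symmetric])
qed

lemma quartic_form_eq_higher_deriv:
  assumes "polynomial_fun_le 4 f"
  shows "quartic_form f h h h h = higher_deriv f [h, h, h, h] x / 24"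
proof -
  have "polynomial_fun_le 0 (higher_deriv f [h, h, h, h])"
    using polynomial_fun_le_higher_deriv[OF assms, of "[h, h, h, h]"] by simp
  then show ?thesis
    unfolding quartic_form_def using polynomial_fun_le_0_constant by metis
qed

lemma quartic_taylor:
  assumes "polynomial_fun_le 4 f"
  shows "f (x + t *\<^sub>R h) = f x + t * higher_deriv f [h] x + t\<^sup>2 * higher_deriv f [h, h] x / 2
     + t ^ 3 * higher_deriv f [h, h, h] x / 6 + t ^ 4 * quartic_form f h h h h"
  unfolding polynomial_fun_le_taylor[OF assms] quartic_form_eq_higher_deriv[OF assms, of h x]
  by (simp add: eval_nat_numeral fact_numeral algebra_simps del: higher_deriv.simps(2))

lemma higher_deriv_scale:
  assumes "polynomial_fun_le n f"
  shows "higher_deriv f (map (\<lambda>h. a *\<^sub>R h) hs) x = a ^ length hs * higher_deriv f hs x"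
proof (induction hs arbitrary: x)
  case (Cons h hs)
  let ?g = "higher_deriv f hs" and ?c = "a ^ length hs"
  let ?D = "frechet_derivative ?g (at x)"
  have D: "(?g has_derivative ?D) (at x)"
    using polynomial_fun_le_differentiable[OF polynomial_fun_le_higher_deriv[OF assms]]
    by (simp add: frechet_derivative_works)
  have "higher_deriv f (map (\<lambda>h. a *\<^sub>R h) hs) = (\<lambda>y. ?c * ?g y)"
    using Cons.IH by blast
  moreover have "frechet_derivative (\<lambda>y. ?c * ?g y) (at x) = (\<lambda>v. ?c * ?D v)"
    by (rule frechet_derivative_at[symmetric]) (intro has_derivative_mult_right D)
  ultimately show ?case
    using linear_scale[OF has_derivative_linear[OF D]] by simp
qed simp

lemma higher_deriv_first_bound:
  assumes "polynomial_fun_le n f"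
  shows "\<exists>C\<ge>0. \<forall>h. \<bar>higher_deriv f [h] x\<bar> \<le> C * norm h"
proof -
  have "bounded_linear (frechet_derivative f (at x))"
    using polynomial_fun_le_differentiable[OF assms] frechet_derivative_works
      has_derivative_bounded_linear by blast
  from bounded_linear.nonneg_bounded[OF this] show ?thesis
    by (auto simp: mult.commute)
qed

section \<open>Bounds on a convex quartic\<close>

lemma convex_on_line_second_deriv_nonneg:
  fixes g :: "real \<Rightarrow> real"
  assumes "convex_on UNIV g"
    and g': "\<And>t. (g has_real_derivative g' t) (at t)"
    and g'': "(g' has_real_derivative D) (at t)"
  shows "0 \<le> D"
proof -
  have tangent: "g' s * (t - s) \<le> g t - g s" for s t
    using convex_on_imp_above_tangent[OF assms(1), of s t "g' s"] g' by simp
  have "mono g'"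
  proof (rule monoI)
    fix s t :: real
    assume "s \<le> t"
    show "g' s \<le> g' t"
    proof (cases "s = t")
      case False
      have "(g' t - g' s) * (t - s) \<ge> 0"
        using tangent[of s t] tangent[of t s] by (simp add: algebra_simps)
      then show ?thesis
        using False \<open>s \<le> t\<close> by (simp add: zero_le_mult_iff)
    qed simp
  qed
  then show ?thesis
    using mono_on_imp_deriv_nonneg[of UNIV g' D t] g'' by simp
qed

text \<open>
  The expression is the second derivative of \<open>f\<close> along the line through \<open>x\<close> in direction \<open>h\<close>, at the
  point with parameter \<open>t\<close>, in terms of the differentials at \<open>x\<close>.
\<close>

lemma convex_quartic_hessian_line_nonneg:
  assumes "polynomial_fun_le 4 f" "convex_on UNIV f"
  shows "0 \<le> higher_deriv f [h, h] x + t * higher_deriv f [h, h, h] x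
           + 12 * t\<^sup>2 * quartic_form f h h h h"
proof -
  let ?g = "\<lambda>s. f (x + s *\<^sub>R h)"
  have "convex_on UNIV ?g"
  proof (rule convex_onI)
    fix t a b :: real
    assume "0 < t" "t < 1"
    then show "f (x + ((1 - t) *\<^sub>R a + t *\<^sub>R b) *\<^sub>R h)
        \<le> (1 - t) * f (x + a *\<^sub>R h) + t * f (x + b *\<^sub>R h)"
      using convex_onD[OF assms(2), of t "x + a *\<^sub>R h" "x + b *\<^sub>R h"]
      by (simp add: algebra_simps)
  qed simp
  moreover have "(?g has_real_derivative higher_deriv f [h] (x + s *\<^sub>R h)) (at s)" for s
    using higher_deriv_line[OF assms(1), of "[]"] by simp
  ultimately have "0 \<le> higher_deriv f [h, h] (x + t *\<^sub>R h)"
    by (rule convex_on_line_second_deriv_nonneg) (rule higher_deriv_line[OF assms(1)])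
  also have "\<dots> = higher_deriv f [h, h] x + t * higher_deriv f [h, h, h] x
      + 12 * t\<^sup>2 * quartic_form f h h h h"
  proof -
    have P: "polynomial_fun_le 2 (higher_deriv f [h, h])"
      using polynomial_fun_le_higher_deriv[OF assms(1), of "[h, h]"] by simp
    show ?thesis
      using polynomial_fun_le_taylor[OF P, of x t h]
      by (simp add: eval_nat_numeral fact_numeral quartic_form_eq_higher_deriv[OF assms(1), of h x])
  qed
  finally show ?thesis .
qed

text \<open>
  A quadratic polynomial in \<open>t\<close> that is nonnegative at both \<open>\<tau>\<close> and \<open>-\<tau>\<close> has its linear term
  dominated by the other two. The free parameter \<open>\<tau>\<close> sets how the bound is shared between them.
\<close>

lemma convex_quartic_third_deriv_bound:
  assumes "polynomial_fun_le 4 f" "convex_on UNIV f" "0 < \<tau>"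
  shows "\<bar>higher_deriv f [h, h, h] x\<bar> / 6
     \<le> higher_deriv f [h, h] x / (6 * \<tau>) + 2 * \<tau> * quartic_form f h h h h"
proof -
  let ?a = "higher_deriv f [h, h] x" and ?b = "higher_deriv f [h, h, h] x"
    and ?c = "quartic_form f h h h h"
  have "\<tau> * \<bar>?b\<bar> \<le> ?a + 12 * \<tau>\<^sup>2 * ?c"
    using convex_quartic_hessian_line_nonneg[OF assms(1,2), of h x \<tau>]
      convex_quartic_hessian_line_nonneg[OF assms(1,2), of h x "- \<tau>"] assms(3)
    by (simp add: abs_if split: if_splits)
  then show ?thesis
    using assms(3) by (simp add: field_simps power2_eq_square)
qed

lemma convex_quartic_upper:
  assumes "polynomial_fun_le 4 f" "convex_on UNIV f" "0 < \<tau>"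
    and "quartic_form f (y - x) (y - x) (y - x) (y - x) \<le> L * norm (y - x) ^ 4"
  shows "f y \<le> relaxed_model f L x \<tau> y"
proof -
  define h where "h = y - x"
  define a b c where "a = higher_deriv f [h, h] x" and "b = higher_deriv f [h, h, h] x"
    and "c = quartic_form f h h h h"
  have "f y = f x + higher_deriv f [h] x + a / 2 + b / 6 + c"
    using quartic_taylor[OF assms(1), of x 1 h] by (simp add: h_def a_def b_def c_def)
  moreover have "b / 6 \<le> a / (6 * \<tau>) + 2 * \<tau> * c"
    using convex_quartic_third_deriv_bound[OF assms(1-3), of h x] by (simp add: a_def b_def c_def)
  moreover have "a / 2 + a / (6 * \<tau>) = (1 + 3 * \<tau>) / (6 * \<tau>) * a"
    using assms(3) by (simp add: field_simps)
  moreover have "(1 + 2 * \<tau>) * c \<le> (1 + 2 * \<tau>) * (L * norm h ^ 4)"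
    using assms(3,4) by (intro mult_left_mono) (auto simp: h_def c_def)
  moreover have "(1 + 2 * \<tau>) * c = c + 2 * \<tau> * c" by (simp add: algebra_simps)
  ultimately show ?thesis
    unfolding relaxed_model_def h_def[symmetric] a_def[symmetric]
    by (simp add: mult.assoc del: higher_deriv.simps(2))
qed

lemma convex_quartic_lower:
  assumes "polynomial_fun_le 4 f" "convex_on UNIV f" "0 < \<tau>" "\<tau> \<le> 1 / 2"
    and "\<mu> * norm (y - x) ^ 4 \<le> quartic_form f (y - x) (y - x) (y - x) (y - x)"
  shows "f x + higher_deriv f [y - x] x
       + (3 * \<tau> - 1) / (6 * \<tau>) * higher_deriv f [y - x, y - x] x
       + (1 - 2 * \<tau>) * \<mu> * norm (y - x) ^ 4 \<le> f y"
proof -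
  define h where "h = y - x"
  define a b c where "a = higher_deriv f [h, h] x" and "b = higher_deriv f [h, h, h] x"
    and "c = quartic_form f h h h h"
  have "f y = f x + higher_deriv f [h] x + a / 2 + b / 6 + c"
    using quartic_taylor[OF assms(1), of x 1 h] by (simp add: h_def a_def b_def c_def)
  moreover have "- b / 6 \<le> a / (6 * \<tau>) + 2 * \<tau> * c"
    using convex_quartic_third_deriv_bound[OF assms(1-3), of h x] by (simp add: a_def b_def c_def)
  moreover have "a / 2 - a / (6 * \<tau>) = (3 * \<tau> - 1) / (6 * \<tau>) * a"
    using assms(3) by (simp add: field_simps)
  moreover have "(1 - 2 * \<tau>) * (\<mu> * norm h ^ 4) \<le> (1 - 2 * \<tau>) * c"
    using assms(4,5) by (intro mult_left_mono) (auto simp: h_def c_def)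
  moreover have "(1 - 2 * \<tau>) * c = c - 2 * \<tau> * c" by (simp add: algebra_simps)
  ultimately show ?thesis
    unfolding h_def[symmetric] a_def[symmetric]
    by (simp add: mult.assoc del: higher_deriv.simps(2))
qed

text \<open>
  The two conditions on \<open>\<alpha>\<close> compare the upper model at the contracted point with \<open>\<alpha>\<close> times the
  lower bound at \<open>y\<close>, the first for the Hessian terms and the second for the quartic terms; one
  factor \<open>\<alpha>\<close> has been cancelled in each. The gradient terms agree.
\<close>

lemma relaxed_model_contraction:
  assumes "polynomial_fun_le 4 f" "convex_on UNIV f"
    and "0 < \<tau>" "\<tau> \<le> 1 / 2" "0 \<le> \<alpha>"
    and hess: "\<alpha> * (1 + 3 * \<tau>) \<le> 3 * \<tau> - 1"
    and quart: "\<alpha> ^ 3 * (1 + 2 * \<tau>) * L \<le> (1 - 2 * \<tau>) * \<mu>"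
    and f4: "\<mu> * norm (y - x) ^ 4 \<le> quartic_form f (y - x) (y - x) (y - x) (y - x)"
  shows "relaxed_model f L x \<tau> (x + \<alpha> *\<^sub>R (y - x)) \<le> (1 - \<alpha>) * f x + \<alpha> * f y"
proof -
  define h where "h = y - x"
  define A where "A = higher_deriv f [h] x"
  define a where "a = higher_deriv f [h, h] x"
  have a: "0 \<le> a"
    using convex_quartic_hessian_line_nonneg[OF assms(1,2), of h x 0] by (simp add: a_def)
  have model: "relaxed_model f L x \<tau> (x + \<alpha> *\<^sub>R h) = f x + \<alpha> * A
     + (1 + 3 * \<tau>) / (6 * \<tau>) * (\<alpha>\<^sup>2 * a) + (1 + 2 * \<tau>) * L * (\<alpha> ^ 4 * norm h ^ 4)"
    using higher_deriv_scale[OF assms(1), of \<alpha> "[h]" x]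
      higher_deriv_scale[OF assms(1), of \<alpha> "[h, h]" x]
    by (simp add: relaxed_model_def A_def a_def power_mult_distrib power2_eq_square assms(5)
        del: higher_deriv.simps(2))
  have "(1 + 3 * \<tau>) / (6 * \<tau>) * (\<alpha>\<^sup>2 * a) = (\<alpha> * (1 + 3 * \<tau>)) * (\<alpha> * a / (6 * \<tau>))"
    by (simp add: power2_eq_square)
  also have "\<dots> \<le> (3 * \<tau> - 1) * (\<alpha> * a / (6 * \<tau>))"
    using hess a assms(3,5) by (intro mult_right_mono) auto
  also have "\<dots> = \<alpha> * ((3 * \<tau> - 1) / (6 * \<tau>) * a)"
    by simp
  finally have hess': "(1 + 3 * \<tau>) / (6 * \<tau>) * (\<alpha>\<^sup>2 * a) \<le> \<alpha> * ((3 * \<tau> - 1) / (6 * \<tau>) * a)" .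
  have "(1 + 2 * \<tau>) * L * (\<alpha> ^ 4 * norm h ^ 4) = (\<alpha> ^ 3 * (1 + 2 * \<tau>) * L) * (\<alpha> * norm h ^ 4)"
    by (simp add: eval_nat_numeral)
  also have "\<dots> \<le> ((1 - 2 * \<tau>) * \<mu>) * (\<alpha> * norm h ^ 4)"
    using quart assms(5) by (intro mult_right_mono) auto
  also have "\<dots> = \<alpha> * ((1 - 2 * \<tau>) * \<mu> * norm h ^ 4)"
    by simp
  finally have quart': "(1 + 2 * \<tau>) * L * (\<alpha> ^ 4 * norm h ^ 4) \<le> \<alpha> * ((1 - 2 * \<tau>) * \<mu> * norm h ^ 4)" .
  have "\<alpha> * (f x + A + (3 * \<tau> - 1) / (6 * \<tau>) * a + (1 - 2 * \<tau>) * \<mu> * norm h ^ 4) \<le> \<alpha> * f y"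
    using convex_quartic_lower[OF assms(1-4) f4] assms(5)
    unfolding A_def a_def h_def by (rule mult_left_mono)
  then have "f x + \<alpha> * A + \<alpha> * ((3 * \<tau> - 1) / (6 * \<tau>) * a) + \<alpha> * ((1 - 2 * \<tau>) * \<mu> * norm h ^ 4)
      \<le> (1 - \<alpha>) * f x + \<alpha> * f y"
    by (simp only: distrib_left left_diff_distrib)
  with hess' quart' show ?thesis
    unfolding h_def[symmetric] model by linarith
qed

lemma relaxed_newton_step:
  assumes "polynomial_fun_le 4 f" "convex_on UNIV f"
    and "0 < \<tau>" "\<tau> \<le> 1 / 2" "0 \<le> \<alpha>" "\<alpha> \<le> 1"
    and "\<alpha> * (1 + 3 * \<tau>) \<le> 3 * \<tau> - 1"
    and "\<alpha> ^ 3 * (1 + 2 * \<tau>) * L \<le> (1 - 2 * \<tau>) * \<mu>"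
    and f4: "\<And>h. \<mu> * norm h ^ 4 \<le> quartic_form f h h h h"
      "\<And>h. quartic_form f h h h h \<le> L * norm h ^ 4"
    and psi: "convex_on D \<psi>"
    and x: "x \<in> D" "is_arg_min (\<lambda>y. relaxed_model f L x \<tau> y + \<psi> y) (\<lambda>y. y \<in> D) x'"
    and y: "y \<in> D"
  shows "f x' + \<psi> x' \<le> (1 - \<alpha>) * (f x + \<psi> x) + \<alpha> * (f y + \<psi> y)"
proof -
  define z where "z = x + \<alpha> *\<^sub>R (y - x)"
  have z_eq: "z = (1 - \<alpha>) *\<^sub>R x + \<alpha> *\<^sub>R y"
    by (simp add: z_def algebra_simps)
  have z: "z \<in> D"
    unfolding z_eq using psi x(1) y assms(5,6)
    by (intro convexD) (auto dest: convex_on_imp_convex)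
  have "f x' + \<psi> x' \<le> relaxed_model f L x \<tau> x' + \<psi> x'"
    using convex_quartic_upper[OF assms(1-3) f4(2)] by simp
  also have "\<dots> \<le> relaxed_model f L x \<tau> z + \<psi> z"
    using x(2) z by (auto simp: is_arg_min_linorder)
  also have "\<dots> \<le> ((1 - \<alpha>) * f x + \<alpha> * f y) + ((1 - \<alpha>) * \<psi> x + \<alpha> * \<psi> y)"
  proof (rule add_mono)
    show "relaxed_model f L x \<tau> z \<le> (1 - \<alpha>) * f x + \<alpha> * f y"
      unfolding z_def by (rule relaxed_model_contraction[OF assms(1-5,7,8) f4(1)])
    show "\<psi> z \<le> (1 - \<alpha>) * \<psi> x + \<alpha> * \<psi> y"
      unfolding z_eq using convex_onD[OF psi assms(5,6) x(1) y] .
  qed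
  finally show ?thesis by (simp add: algebra_simps)
qed

section \<open>Existence of a minimizer\<close>

lemma compact_coefficient_box:
  fixes K :: "'a \<Rightarrow> real set"
  assumes "\<And>i. compact (K i)"
  shows "compact (Pi\<^sub>E UNIV K)"
  using compactin_PiE[of "\<lambda>i. euclidean" UNIV K] assms by (simp add: euclidean_product_topology)

text \<open>
  A norm on a finite-dimensional space dominates the maximum of the coordinates: it is positive on
  the compact unit sphere of the maximum norm, hence bounded away from zero there, and scaling does
  the rest. The sphere lives in the space of all functions with the product topology; coordinates
  outside the basis are pinned to zero, so that Tychonoff's theorem makes each of its faces compact.
\<close>

lemma finite_dim_coefficients_bounded:
  fixes B :: "'a::real_normed_vector set"
  assumes "finite B" "independent B"
  shows "\<exists>m>0. \<forall>c. \<forall>b\<in>B. m * \<bar>c b\<bar> \<le> norm (\<Sum>b\<in>B. c b *\<^sub>R b)"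
proof (cases "B = {}")
  case True
  then show ?thesis by (intro exI[of _ 1]) auto
next
  case False
  define T where "T = (\<lambda>c. \<Sum>b\<in>B. c b *\<^sub>R b)"
  have contT: "continuous_on X T" for X
    unfolding T_def
    by (intro continuous_intros continuous_on_subset[OF continuous_on_product_coordinates]) auto
  \<comment> \<open>\<open>Pi\<^sub>E UNIV (K b)\<close> is the pair of opposite faces of the unit cube on which coordinate \<open>b\<close> has
    absolute value one.\<close>
  define K where "K = (\<lambda>b i. if i = b then {-1, 1} else if i \<in> B then {-1..1} else {0::real})"
  define S where "S = (\<Union>b\<in>B. Pi\<^sub>E UNIV (K b))"
  have "compact S"
    unfolding S_def using assms(1)
    by (intro compact_UN ballI compact_coefficient_box) (auto simp: K_def)
  moreover have "S \<noteq> {}"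
    using False by (auto simp: S_def K_def PiE_eq_empty_iff)
  moreover have "continuous_on S (\<lambda>c. norm (T c))"
    by (intro continuous_intros contT)
  ultimately obtain c0 where c0: "c0 \<in> S" "\<And>c. c \<in> S \<Longrightarrow> norm (T c0) \<le> norm (T c)"
    using continuous_attains_inf by metis
  obtain b0 where "b0 \<in> B" "c0 \<in> Pi\<^sub>E UNIV (K b0)"
    using c0(1) by (auto simp: S_def)
  then have "b0 \<in> B" "c0 b0 \<in> K b0 b0"
    by (auto dest: PiE_mem)
  then have "b0 \<in> B" "c0 b0 \<noteq> 0"
    by (auto simp: K_def)
  then have "T c0 \<noteq> 0"
    using independentD[OF assms(2,1) order_refl, of c0 b0] by (auto simp: T_def)
  have "norm (T c0) * \<bar>c b\<bar> \<le> norm (T c)" if "b \<in> B" for c b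
  proof -
    define M where "M = Max ((\<lambda>i. \<bar>c i\<bar>) ` B)"
    have M: "\<bar>c i\<bar> \<le> M" if "i \<in> B" for i
      unfolding M_def using assms(1) that by (intro Max_ge) auto
    have "M \<in> (\<lambda>i. \<bar>c i\<bar>) ` B"
      unfolding M_def using assms(1) False by (intro Max_in) auto
    then obtain b1 where b1: "b1 \<in> B" "M = \<bar>c b1\<bar>" by auto
    show ?thesis
    proof (cases "M = 0")
      case True
      then show ?thesis using M[OF that] by simp
    next
      case False
      with b1 have "0 < M" by simp
      let ?d = "\<lambda>i. if i \<in> B then c i / M else 0"
      have "c i / M \<in> {-1..1}" if "i \<in> B" for i
        using M[OF that] \<open>0 < M\<close> by (simp add: abs_le_iff field_simps)
      moreover have "c b1 / M \<in> {-1, 1}"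
        using b1(2) \<open>0 < M\<close> by (auto simp: abs_if split: if_splits)
      ultimately have "?d \<in> Pi\<^sub>E UNIV (K b1)"
        using b1(1) by (simp add: K_def PiE_iff)
      then have "norm (T c0) \<le> norm (T ?d)"
        using c0(2) b1 by (auto simp: S_def)
      also have "T ?d = (1 / M) *\<^sub>R T c"
        by (simp add: T_def scaleR_sum_right)
      finally have "norm (T c0) * M \<le> norm (T c)"
        using \<open>0 < M\<close> by (simp add: field_simps)
      moreover have "norm (T c0) * \<bar>c b\<bar> \<le> norm (T c0) * M"
        using M[OF that] by (intro mult_left_mono) auto
      ultimately show ?thesis by linarith
    qed
  qed
  then show ?thesis
    using \<open>T c0 \<noteq> 0\<close> unfolding T_def by (intro exI[of _ "norm (T c0)"]) (auto simp: T_def)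
qed

lemma finite_dim_compact_cball:
  fixes z :: "'a::real_normed_vector"
  assumes "\<exists>B::'a set. finite B \<and> span B = UNIV"
  shows "compact (cball z r)"
proof -
  obtain B0 :: "'a set" where B0: "finite B0" "span B0 = UNIV" using assms by blast
  obtain B where B: "B \<subseteq> B0" "independent B" "B0 \<subseteq> span B"
    using maximal_independent_subset by blast
  have "finite B" using B0 B finite_subset by blast
  have "span B = UNIV"
    using B0(2) B(3) span_mono[OF B(3)] by (auto simp: span_span)
  define T where "T = (\<lambda>c. \<Sum>b\<in>B. c b *\<^sub>R b)"
  obtain m where m: "0 < m" "\<And>c b. b \<in> B \<Longrightarrow> m * \<bar>c b\<bar> \<le> norm (T c)"
    using finite_dim_coefficients_bounded[OF \<open>finite B\<close> B(2)] unfolding T_def by blast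
  define s where "s = norm z + r"
  define K where "K = Pi\<^sub>E UNIV (\<lambda>i. if i \<in> B then {- (s / m)..s / m} else {0::real})"
  have "compact K"
    unfolding K_def by (intro compact_coefficient_box) auto
  moreover have "continuous_on K T"
    unfolding T_def
    by (intro continuous_intros continuous_on_subset[OF continuous_on_product_coordinates]) auto
  ultimately have "compact (T ` K)" by (rule compact_continuous_image[rotated])
  moreover have "cball z r \<subseteq> T ` K"
  proof
    fix v assume "v \<in> cball z r"
    then have v: "norm v \<le> s"
      using norm_triangle_ineq2[of v z] by (simp add: s_def dist_norm norm_minus_commute)
    have "v \<in> range (\<lambda>u. \<Sum>b\<in>B. u b *\<^sub>R b)"
      using span_finite[OF \<open>finite B\<close>] \<open>span B = UNIV\<close> by auto
    then obtain u where u: "v = T u" by (auto simp: T_def)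
    let ?d = "\<lambda>i. if i \<in> B then u i else 0"
    have "\<bar>u b\<bar> \<le> s / m" if "b \<in> B" for b
    proof -
      have "m * \<bar>u b\<bar> \<le> s"
        using m(2)[OF that, of u] v unfolding u by linarith
      then show ?thesis using m(1) by (simp add: field_simps)
    qed
    then have "?d \<in> K" by (auto simp: K_def abs_le_iff minus_le_iff)
    moreover have "T ?d = v" by (simp add: u T_def)
    ultimately show "v \<in> T ` K" by blast
  qed
  ultimately have "compact (T ` K \<inter> cball z r)"
    by (intro compact_Int_closed) auto
  moreover have "T ` K \<inter> cball z r = cball z r"
    using \<open>cball z r \<subseteq> T ` K\<close> by blast
  ultimately show ?thesis by simp
qed

text \<open>
  Closedness of the epigraph means that sublevel sets are closed. The sublevel sets at the values of
  \<open>g\<close> on \<open>D \<inter> K\<close> form a chain of sets that meet the compact set \<open>K\<close>, so they have a common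
  point in \<open>K\<close>, and such a point is a minimizer.
\<close>

lemma closed_epigraph_attains_min:
  fixes g :: "'a::real_normed_vector \<Rightarrow> real"
  assumes "closed (epigraph D g)" "compact K" "D \<inter> K \<noteq> {}"
  shows "\<exists>z\<in>D \<inter> K. \<forall>y\<in>D \<inter> K. g z \<le> g y"
proof -
  define A where "A = (\<lambda>c. {y \<in> D. g y \<le> c})"
  have closedA: "closed (A c)" for c
  proof -
    have "A c = (\<lambda>y. (y, c)) -` epigraph D g"
      by (auto simp: A_def mem_epigraph)
    then show ?thesis
      using assms(1) by (auto intro!: closed_vimage continuous_intros)
  qed
  have "K \<inter> (\<Inter>y\<in>D \<inter> K. A (g y)) \<noteq> {}"
  proof (rule compact_imp_fip_image[OF assms(2) closedA])
    fix I assume I: "finite I" "I \<subseteq> D \<inter> K"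
    show "K \<inter> (\<Inter>y\<in>I. A (g y)) \<noteq> {}"
    proof (cases "I = {}")
      case True
      then show ?thesis using assms(3) by auto
    next
      case False
      then have "arg_min_on g I \<in> I" "\<forall>y\<in>I. g (arg_min_on g I) \<le> g y"
        using I(1) by (auto intro: arg_min_if_finite arg_min_least)
      then have "arg_min_on g I \<in> K \<inter> (\<Inter>y\<in>I. A (g y))"
        using I(2) by (auto simp: A_def)
      then show ?thesis by blast
    qed
  qed
  then show ?thesis using assms(3) by (auto simp: A_def)
qed

lemma closed_epigraph_add_continuous:
  fixes f g :: "'a::real_normed_vector \<Rightarrow> real"
  assumes "closed (epigraph D g)" "continuous_on UNIV f"
  shows "closed (epigraph D (\<lambda>y. f y + g y))"
proof -
  \<comment> \<open>A vertical shear carries one epigraph onto the other.\<close>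
  have "epigraph D (\<lambda>y. f y + g y) = (\<lambda>p. (fst p, snd p - f (fst p))) -` epigraph D g"
    by (auto simp: epigraph_def)
  moreover have "continuous_on UNIV (\<lambda>p::'a \<times> real. (fst p, snd p - f (fst p)))"
    by (intro continuous_intros continuous_on_compose2[OF assms(2)]) auto
  ultimately show ?thesis
    using assms(1) by (simp add: closed_vimage)
qed

text \<open>
  Convexity on the segment from \<open>x\<close> to \<open>y\<close>, used at the point \<open>z\<close> at distance one from \<open>x\<close>: a decrease
  over the whole segment that is steeper than \<open>M\<close> per unit length would already show at \<open>z\<close>.
\<close>

lemma convex_linear_growth_lower:
  fixes g :: "'a::real_normed_vector \<Rightarrow> real"
  assumes "convex_on D g" "x \<in> D" "y \<in> D" "1 \<le> norm (y - x)"
    and lower: "\<And>z. z \<in> D \<inter> cball x 1 \<Longrightarrow> g x - M \<le> g z"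
  shows "g x - M * norm (y - x) \<le> g y"
proof -
  define r where "r = norm (y - x)"
  have r: "1 \<le> r" using assms(4) by (simp add: r_def)
  define z where "z = (1 - 1 / r) *\<^sub>R x + (1 / r) *\<^sub>R y"
  have "z \<in> D"
    unfolding z_def using assms(1-3) r
    by (intro convexD) (auto dest: convex_on_imp_convex)
  moreover have "z - x = (1 / r) *\<^sub>R (y - x)"
    by (simp add: z_def algebra_simps)
  then have "norm (z - x) = 1" using r by (simp add: r_def[symmetric])
  ultimately have "g x - M \<le> g z"
    using lower by (simp add: dist_norm norm_minus_commute)
  also have "g z \<le> (1 - 1 / r) * g x + (1 / r) * g y"
    unfolding z_def using convex_onD[OF assms(1) _ _ assms(2,3), of "1 / r"] r by simp
  finally have "r * (g x - M) \<le> r * ((1 - 1 / r) * g x + (1 / r) * g y)"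
    using r by (intro mult_left_mono) auto
  also have "\<dots> = (r - 1) * g x + g y"
    using r by (simp add: field_simps)
  finally show ?thesis by (simp add: r_def[symmetric] algebra_simps)
qed

lemma composite_quartic_min_exists:
  fixes f \<psi> :: "'a::real_normed_vector \<Rightarrow> real"
  assumes fin: "\<exists>B::'a set. finite B \<and> span B = UNIV"
    and f: "polynomial_fun_le 4 f" "convex_on UNIV f"
    and "0 < \<mu>" and f4: "\<And>h. \<mu> * norm h ^ 4 \<le> quartic_form f h h h h"
    and psi: "closed_convex_fun D \<psi>" and x: "x \<in> D"
  shows "\<exists>xs. is_arg_min (\<lambda>y. f y + \<psi> y) (\<lambda>y. y \<in> D) xs"
proof -
  have conv: "convex_on D \<psi>" and clo: "closed (epigraph D \<psi>)"
    using psi by (auto simp: closed_convex_fun_def)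
  obtain C where C: "0 \<le> C" "\<And>h. \<bar>higher_deriv f [h] x\<bar> \<le> C * norm h"
    using higher_deriv_first_bound[OF f(1)] by blast
  have "D \<inter> cball x 1 \<noteq> {}" using x by auto
  then obtain w where w: "w \<in> D" "\<And>z. z \<in> D \<inter> cball x 1 \<Longrightarrow> \<psi> w \<le> \<psi> z"
    using closed_epigraph_attains_min[OF clo finite_dim_compact_cball[OF fin]] by blast
  define M where "M = \<psi> x - \<psi> w"
  \<comment> \<open>Beyond distance \<open>R\<close> the quartic growth \<open>\<mu>/3 r\<^sup>4\<close> of \<open>f\<close> exceeds the linear decrease
    \<open>(C + M) r\<close> that the gradient and \<open>\<psi>\<close> allow.\<close>
  define R where "R = max 1 (3 * (C + M) / \<mu>)"
  have far: "f x + \<psi> x \<le> f y + \<psi> y" if "y \<in> D" "R \<le> norm (y - x)" for y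
  proof -
    define h where "h = y - x"
    define r where "r = norm h"
    have r: "1 \<le> r" "3 * (C + M) / \<mu> \<le> r"
      using that(2) by (auto simp: R_def r_def h_def)
    \<comment> \<open>At \<open>\<tau> = 1/3\<close> the Hessian term of the lower bound vanishes.\<close>
    have "f x + higher_deriv f [h] x + \<mu> / 3 * r ^ 4 \<le> f y"
      using convex_quartic_lower[OF f, of "1 / 3" \<mu> y x] f4[of "y - x"]
      by (simp add: h_def r_def)
    moreover have "- (C * r) \<le> higher_deriv f [h] x"
      using C(2)[of h] by (simp add: r_def abs_le_iff)
    moreover have "\<psi> x - M * r \<le> \<psi> y"
      using convex_linear_growth_lower[OF conv x that(1), of M] w(2) r(1)
      by (simp add: M_def r_def h_def)
    moreover have "(C + M) * r \<le> \<mu> / 3 * r ^ 4"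
    proof -
      have "C + M \<le> \<mu> / 3 * r" using r(2) \<open>0 < \<mu>\<close> by (simp add: field_simps)
      also have "\<dots> \<le> \<mu> / 3 * r ^ 3"
        using r(1) \<open>0 < \<mu>\<close> self_le_power[of r 3] by (intro mult_left_mono) auto
      finally have "(C + M) * r \<le> \<mu> / 3 * r ^ 3 * r"
        using r(1) by (intro mult_right_mono) auto
      then show ?thesis by (simp add: eval_nat_numeral mult.assoc)
    qed
    moreover have "(C + M) * r = C * r + M * r" by (simp add: algebra_simps)
    ultimately show ?thesis by linarith
  qed
  have "x \<in> cball x R" by (simp add: R_def)
  then have "D \<inter> cball x R \<noteq> {}" using x by blast
  then obtain xs where xs: "xs \<in> D" "\<And>y. y \<in> D \<inter> cball x R \<Longrightarrow> f xs + \<psi> xs \<le> f y + \<psi> y"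
    using closed_epigraph_attains_min
      [OF closed_epigraph_add_continuous[OF clo polynomial_fun_le_continuous[OF f(1)]]
        finite_dim_compact_cball[OF fin]] by blast
  have "f xs + \<psi> xs \<le> f y + \<psi> y" if "y \<in> D" for y
  proof (cases "y \<in> cball x R")
    case True
    then show ?thesis using xs(2) that by blast
  next
    case False
    then have "f x + \<psi> x \<le> f y + \<psi> y"
      using far[OF that] by (simp add: dist_norm norm_minus_commute)
    moreover have "f xs + \<psi> xs \<le> f x + \<psi> x"
      using xs(2) x \<open>x \<in> cball x R\<close> by blast
    ultimately show ?thesis by linarith
  qed
  then show ?thesis
    using xs(1) by (intro exI[of _ xs]) (auto simp: is_arg_min_linorder)
qed

section \<open>Linear convergence\<close>

text \<open>
  In terms of \<open>s = 1 + 5\<kappa>\<close> the parameters are \<open>\<alpha> = \<kappa>/s\<close> and \<open>\<tau> = 1/2 - 1/(6s)\<close>, and the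
  definition of \<open>\<kappa>\<close> amounts to \<open>\<mu> = 5 \<kappa>\<^sup>3 L\<close>. The condition on the Hessian terms becomes
  \<open>1 + 3\<tau> \<le> 5/2\<close>, since \<open>3\<tau> - 1\<close> equals \<open>5\<alpha>/2\<close>; the one on the quartic terms becomes
  \<open>6s - 1 \<le> 5s\<^sup>3\<close>, in which \<open>s = 1\<close> gives equality.
\<close>

lemma relaxed_newton_parameters:
  fixes \<mu> L q \<kappa> \<tau> \<alpha> :: real
  assumes "0 < \<mu>" "\<mu> \<le> L" and q: "q = \<mu> / L"
    and kappa: "\<kappa> = (q / 5) powr (1 / 3)"
    and tau: "\<tau> = 1 / 2 - 1 / (6 * (1 + 5 * \<kappa>))"
    and alpha: "\<alpha> = \<kappa> / (1 + 5 * \<kappa>)"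
  shows "0 < \<alpha>" "\<alpha> < 1"
    and "\<alpha> * (1 + 3 * \<tau>) \<le> 3 * \<tau> - 1"
    and "\<alpha> ^ 3 * (1 + 2 * \<tau>) * L \<le> (1 - 2 * \<tau>) * \<mu>"
proof -
  have "0 < q" using assms(1-3) by simp
  then have k: "0 < \<kappa>" and k3: "5 * \<kappa> ^ 3 = q"
    by (auto simp: kappa powr_power)
  define s where "s = 1 + 5 * \<kappa>"
  have s: "1 < s" "\<alpha> = \<kappa> / s" "\<tau> = 1 / 2 - 1 / (6 * s)" "\<kappa> = (s - 1) / 5"
    using k by (auto simp: s_def alpha tau)
  show "0 < \<alpha>" "\<alpha> < 1" using k by (auto simp: alpha field_simps)
  have minus: "3 * \<tau> - 1 = 5 / 2 * \<alpha>"
    using s(1) unfolding s(2,3) s(4) by (simp add: field_simps)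
  have "1 + 3 * \<tau> \<le> 5 / 2"
    using s(1) by (simp add: s(3) field_simps)
  then have "\<alpha> * (1 + 3 * \<tau>) \<le> \<alpha> * (5 / 2)"
    using \<open>0 < \<alpha>\<close> by (intro mult_left_mono) auto
  then show "\<alpha> * (1 + 3 * \<tau>) \<le> 3 * \<tau> - 1"
    using minus by simp
  have mu: "\<mu> = 5 * \<kappa> ^ 3 * L" using k3 q assms(1,2) by simp
  have "\<alpha> ^ 3 * (1 + 2 * \<tau>) * L = \<kappa> ^ 3 * L * ((1 + 2 * \<tau>) / s ^ 3)"
    by (simp add: s(2) power_divide)
  also have "\<dots> \<le> \<kappa> ^ 3 * L * (5 * (1 - 2 * \<tau>))"
  proof (intro mult_left_mono)
    have "(6 * s - 1) \<le> 5 * s ^ 3"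
    proof -
      have "0 \<le> (s - 1) * (5 * s\<^sup>2 + 5 * s - 1)"
        using s(1) by (intro mult_nonneg_nonneg) (auto intro: add_nonneg_nonneg simp: add_increasing)
      then show ?thesis by (simp add: algebra_simps eval_nat_numeral)
    qed
    have "(1 + 2 * \<tau>) / s ^ 3 = (6 * s - 1) / (3 * s * s ^ 3)"
      using s(1) by (simp add: s(3) field_simps)
    also have "\<dots> \<le> 5 * s ^ 3 / (3 * s * s ^ 3)"
      using s(1) \<open>6 * s - 1 \<le> 5 * s ^ 3\<close> by (intro divide_right_mono) auto
    also have "\<dots> = 5 * (1 - 2 * \<tau>)"
      using s(1) by (simp add: s(3) field_simps)
    finally show "(1 + 2 * \<tau>) / s ^ 3 \<le> 5 * (1 - 2 * \<tau>)" .
  qed (use k assms(1,2) in auto)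
  also have "\<dots> = (1 - 2 * \<tau>) * \<mu>" by (simp add: mu)
  finally show "\<alpha> ^ 3 * (1 + 2 * \<tau>) * L \<le> (1 - 2 * \<tau>) * \<mu>" .
qed

theorem theorem5:
  fixes f \<psi> :: "'a::real_normed_vector \<Rightarrow> real"
    and D :: "'a set"
    and x :: "nat \<Rightarrow> 'a"
    and \<mu> L q \<kappa> \<tau> \<alpha> :: real
  assumes finite_dim: "\<exists>B::'a set. finite B \<and> span B = UNIV"
    and f_quartic: "polynomial_fun_le 4 f"
    and f_convex: "convex_on UNIV f"
    and f4_pos_def: "\<And>h. h \<noteq> 0 \<Longrightarrow> quartic_form f h h h h > 0"
    and mu_L: "0 < \<mu>" "\<mu> \<le> L"
    and f4_lower: "\<And>h. \<mu> * norm h ^ 4 \<le> quartic_form f h h h h"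
    and f4_upper: "\<And>h. quartic_form f h h h h \<le> L * norm h ^ 4"
    and psi: "closed_convex_fun D \<psi>" "D \<noteq> {}"
    and q: "q = \<mu> / L"
    and kappa: "\<kappa> = (q / 5) powr (1 / 3)"
    and tau: "\<tau> = 1 / 2 - 1 / (6 * (1 + 5 * \<kappa>))"
    and alpha: "\<alpha> = \<kappa> / (1 + 5 * \<kappa>)"
    and newton: "relaxed_quartic_newton f L D \<psi> \<tau> x"
  shows "\<exists>xs. is_arg_min (\<lambda>y. f y + \<psi> y) (\<lambda>y. y \<in> D) xs \<and>
    (\<forall>k. (f (x k) + \<psi> (x k)) - (f xs + \<psi> xs)
          \<le> (1 - \<alpha>) ^ k * ((f (x 0) + \<psi> (x 0)) - (f xs + \<psi> xs)))"
proof -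
  have \<tau>: "0 < \<tau>" "\<tau> \<le> 1 / 2" and x0: "x 0 \<in> D"
    and step: "\<And>k. is_arg_min (\<lambda>y. relaxed_model f L (x k) \<tau> y + \<psi> y) (\<lambda>y. y \<in> D) (x (Suc k))"
    using newton by (auto simp: relaxed_quartic_newton_def)
  note par = relaxed_newton_parameters[OF mu_L q kappa tau alpha]
  have conv: "convex_on D \<psi>" using psi(1) by (simp add: closed_convex_fun_def)
  have xD: "x k \<in> D" for k
    using x0 step by (cases k) (auto simp: is_arg_min_linorder)
  obtain xs where xs: "is_arg_min (\<lambda>y. f y + \<psi> y) (\<lambda>y. y \<in> D) xs"
    using composite_quartic_min_exists
      [OF finite_dim f_quartic f_convex mu_L(1) f4_lower psi(1) x0] by blast
  define gap where "gap = (\<lambda>k. (f (x k) + \<psi> (x k)) - (f xs + \<psi> xs))"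
  have "gap (Suc k) \<le> (1 - \<alpha>) * gap k" for k
  proof -
    have "f (x (Suc k)) + \<psi> (x (Suc k))
        \<le> (1 - \<alpha>) * (f (x k) + \<psi> (x k)) + \<alpha> * (f xs + \<psi> xs)"
      using xs par
      by (intro relaxed_newton_step[OF f_quartic f_convex \<tau> _ _ _ _ f4_lower f4_upper conv xD step])
        (auto simp: is_arg_min_linorder)
    then show ?thesis by (simp add: gap_def algebra_simps)
  qed
  then have "gap k \<le> (1 - \<alpha>) ^ k * gap 0" for k
  proof (induction k)
    case (Suc k)
    have "gap (Suc k) \<le> (1 - \<alpha>) * gap k" using Suc.prems .
    also have "\<dots> \<le> (1 - \<alpha>) * ((1 - \<alpha>) ^ k * gap 0)"
      using Suc par(2) by (intro mult_left_mono) auto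
    finally show ?case by (simp add: mult.assoc)
  qed simp
  then show ?thesis using xs unfolding gap_def by blast
qed

end
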